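(* Consider a general network with routes of length one and a fixed number of flows $n=(n_i)_{i\in I}$, and let $x=(x_i)_{i\in I}$ be the optimal rate allocation. Then the minimal and maximal rates are $$\min_{i\in I}x_i=\min_{J'\in\mathscr{SC}(J)}\frac{C(J')}{\sum_{i\in I(J')}n_i},\qquad \max_{i\in I}x_i=\max_{J'\in\mathscr{C}(J)}\frac{C(J')}{\sum_{i:\,J(i)\cap J'\neq\emptyset}n_i}.$$
   Context: Network: $I$ is a finite set of users (flow types), $J$ a finite set of resources, resource $j$ has capacity $C_j>0$, and user $i$ can use exactly the resources in the nonempty set $J(i)\subseteq J$ (each route is a single resource). $n_i$ is the number of flows of type $i$. Optimal allocation: let $U$ be a strictly concave, strictly increasing, differentiable utility function common to all users. $x=(x_i)_{i\in I}$ is the solution of: maximize $\sum_{i\in I} n_iU(x_i)$ subject to $\sum_{i: j\in J(i)} n_ix_i^j\le C_j$ for all $j\in J$; $\sum_{j\in J(i)}x_i^j=x_i$ for all $i\in I$; $x_i^j\ge 0$ for all $i\in I$, $j\in J(i)$. Convention: $x_i=0$ if $n_i=0$. The allocation does not depend on the choice of $U$. Notation: for $J'\subseteq J$, $C(J')=\sum_{j\in J'}C_j$ and $I(J')=\{i\in I: J(i)\subseteq J'\}$; a fraction with zero denominator and positive numerator is $+\infty$. Connectivity: a pair $(I',J')$ with $I'\subseteq I$, $J'\subseteq J$ is connected if $J'$ cannot be partitioned into nonempty $J_1,J_2$ such that $I'$ can be partitioned into (possibly empty) $I_1,I_2$ with $J(i)\cap J_2=\emptyset$ for $i\in I_1$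 and $J(i)\cap J_1=\emptyset$ for $i\in I_2$. A nonempty $J'\subseteq J$ is connected if $(I,J')$ is connected, and strongly connected if $(I(J'),J')$ is connected. $\mathscr{C}(J)$ and $\mathscr{SC}(J)$ denote the sets of connected, respectively strongly connected, subsets of $J$.
   Formalization: The minimum formula is proved when all n_i>0 (and, if some n_i>0, with the minimum over users with n_i>0); the maximum formula when every resource can be used by some user with n_i>0. Otherwise the formulas fail: the left minimum is 0, or the right maximum is +∞. *)

theory Defs
  imports "HOL-Analysis.Analysis"
begin

text \<open>
  Networks with routes of length one: \<open>I\<close> is the set of users, \<open>J\<close> the set of resources,
  \<open>C j\<close> the capacity of resource \<open>j\<close>, \<open>R i\<close> the set of resources that user \<open>i\<close> can use
  (written $J(i)$ on paper) and \<open>n i\<close> the number of flows of user \<open>i\<close>.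
\<close>

definition network ::
  "'i set \<Rightarrow> 'j set \<Rightarrow> ('j \<Rightarrow> real) \<Rightarrow> ('i \<Rightarrow> 'j set) \<Rightarrow> bool" where
  "network I J C R \<longleftrightarrow>
     finite I \<and> I \<noteq> {} \<and> finite J \<and> (\<forall>j\<in>J. C j > 0) \<and> (\<forall>i\<in>I. R i \<noteq> {} \<and> R i \<subseteq> J)"

definition strictly_concave_on :: "real set \<Rightarrow> (real \<Rightarrow> real) \<Rightarrow> bool" where
  "strictly_concave_on S f \<longleftrightarrow> convex S \<and>
     (\<forall>a\<in>S. \<forall>b\<in>S. \<forall>t. a \<noteq> b \<longrightarrow> 0 < t \<longrightarrow> t < 1 \<longrightarrow>
        f ((1 - t) * a + t * b) > (1 - t) * f a + t * f b)"

text \<open>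
  The set \<open>D\<close> of rates at which the utility is finite is either \<open>{0..}\<close> or \<open>{0<..}\<close>. The second
  case covers utilities such as \<open>ln\<close>, which are \<open>-\<infinity>\<close> at rate zero. Differentiability is required
  at positive rates only, so that for instance \<open>sqrt\<close> is a utility function on \<open>{0..}\<close>.
\<close>

definition utility_on :: "real set \<Rightarrow> (real \<Rightarrow> real) \<Rightarrow> bool" where
  "utility_on D U \<longleftrightarrow> (D = {0..} \<or> D = {0<..}) \<and>
     strictly_concave_on D U \<and> strict_mono_on D U \<and> U differentiable_on {0<..}"

text \<open>\<open>y i j\<close> is the rate that each flow of user \<open>i\<close> obtains from resource \<open>j\<close>.\<close>

definition feasible ::
  "'i set \<Rightarrow> 'j set \<Rightarrow> ('j \<Rightarrow> real) \<Rightarrow> ('i \<Rightarrow> 'j set) \<Rightarrow> ('i \<Rightarrow> nat) \<Rightarrow> ('i \<Rightarrow> real) \<Rightarrow> bool" where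
  "feasible I J C R n x \<longleftrightarrow>
     (\<exists>y. (\<forall>j\<in>J. (\<Sum>i | i \<in> I \<and> j \<in> R i. real (n i) * y i j) \<le> C j) \<and>
          (\<forall>i\<in>I. (\<Sum>j\<in>R i. y i j) = x i) \<and>
          (\<forall>i\<in>I. \<forall>j\<in>R i. 0 \<le> y i j))"

definition finite_utility ::
  "real set \<Rightarrow> 'i set \<Rightarrow> ('i \<Rightarrow> nat) \<Rightarrow> ('i \<Rightarrow> real) \<Rightarrow> bool" where
  "finite_utility D I n x \<longleftrightarrow> (\<forall>i\<in>I. n i > 0 \<longrightarrow> x i \<in> D)"

text \<open>
  Allocations with a total utility of \<open>-\<infinity>\<close> are left out of the maximization; allocations of
  finite total utility always exist. The last conjunct is the convention for users without flows.
\<close>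

definition optimal_allocation ::
  "'i set \<Rightarrow> 'j set \<Rightarrow> ('j \<Rightarrow> real) \<Rightarrow> ('i \<Rightarrow> 'j set) \<Rightarrow> real set \<Rightarrow> (real \<Rightarrow> real) \<Rightarrow>
   ('i \<Rightarrow> nat) \<Rightarrow> ('i \<Rightarrow> real) \<Rightarrow> bool" where
  "optimal_allocation I J C R D U n x \<longleftrightarrow>
     feasible I J C R n x \<and> finite_utility D I n x \<and>
     (\<forall>x'. feasible I J C R n x' \<longrightarrow> finite_utility D I n x' \<longrightarrow>
        (\<Sum>i\<in>I. real (n i) * U (x' i)) \<le> (\<Sum>i\<in>I. real (n i) * U (x i))) \<and>
     (\<forall>i\<in>I. n i = 0 \<longrightarrow> x i = 0)"

definition users_within :: "'i set \<Rightarrow> ('i \<Rightarrow> 'j set) \<Rightarrow> 'j set \<Rightarrow> 'i set" where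
  "users_within I R J' = {i \<in> I. R i \<subseteq> J'}"

definition connected_pair :: "('i \<Rightarrow> 'j set) \<Rightarrow> 'i set \<Rightarrow> 'j set \<Rightarrow> bool" where
  "connected_pair R I' J' \<longleftrightarrow>
     \<not> (\<exists>J1 J2. J1 \<noteq> {} \<and> J2 \<noteq> {} \<and> J1 \<union> J2 = J' \<and> J1 \<inter> J2 = {} \<and>
          (\<exists>I1 I2. I1 \<union> I2 = I' \<and> I1 \<inter> I2 = {} \<and>
             (\<forall>i\<in>I1. R i \<inter> J2 = {}) \<and> (\<forall>i\<in>I2. R i \<inter> J1 = {})))"

definition connected_subsets :: "'i set \<Rightarrow> 'j set \<Rightarrow> ('i \<Rightarrow> 'j set) \<Rightarrow> 'j set set" where
  "connected_subsets I J R = {J'. J' \<noteq> {} \<and> J' \<subseteq> J \<and> connected_pair R I J'}"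

definition strongly_connected_subsets ::
  "'i set \<Rightarrow> 'j set \<Rightarrow> ('i \<Rightarrow> 'j set) \<Rightarrow> 'j set set" where
  "strongly_connected_subsets I J R =
     {J'. J' \<noteq> {} \<and> J' \<subseteq> J \<and> connected_pair R (users_within I R J') J'}"

text \<open>
  The ratios are taken in \<^typ>\<open>ereal\<close>, where a positive number divided by zero is \<open>\<infinity>\<close>,
  unlike in \<^typ>\<open>real\<close>.
\<close>

definition inner_ratio ::
  "'i set \<Rightarrow> ('j \<Rightarrow> real) \<Rightarrow> ('i \<Rightarrow> 'j set) \<Rightarrow> ('i \<Rightarrow> nat) \<Rightarrow> 'j set \<Rightarrow> ereal" where
  "inner_ratio I C R n J' =
     ereal (\<Sum>j\<in>J'. C j) / ereal (\<Sum>i\<in>users_within I R J'. real (n i))"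

definition outer_ratio ::
  "'i set \<Rightarrow> ('j \<Rightarrow> real) \<Rightarrow> ('i \<Rightarrow> 'j set) \<Rightarrow> ('i \<Rightarrow> nat) \<Rightarrow> 'j set \<Rightarrow> ereal" where
  "outer_ratio I C R n J' =
     ereal (\<Sum>j\<in>J'. C j) / ereal (\<Sum>i | i \<in> I \<and> R i \<inter> J' \<noteq> {}. real (n i))"

end

theory Submission
  imports Defs
begin

text \<open>
  Two local exchange arguments capture optimality. A resource accessible to a user with flows is
  saturated, and if user \<open>i\<close> gets a positive rate from \<open>j\<close>, then every user with flows that can use
  \<open>j\<close> has a rate at least \<open>x i\<close>, since otherwise strict concavity rewards shifting capacity.

  Counting capacity shows that all inner ratios are at least the minimal rate \<open>m\<close> and all outer
  ratios are at most the maximal rate \<open>M\<close>. The resources accessible to the users of rate \<open>m\<close>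
  serve no other user, and the resources serving the users of rate \<open>M\<close> are accessible to no other
  user, so both bounds are attained. Since capacities and numbers of flows add up
  when a set of resources is disconnected, a minimal set attaining the bound is connected.
\<close>

section \<open>Strict concavity and the exchange arguments\<close>

text \<open>Both difference quotients are compared with the slope of the chord from \<open>u\<close>
  to \<open>v\<close>: the forward one at \<open>u\<close> is steeper, the backward one at
  \<open>v\<close> flatter. The two intervals may overlap. With \<open>u\<close> a smaller and
  \<open>v\<close> a larger rate, this says that the poorer user gains more than the richer one
  loses.\<close>

lemma strictly_concave_on_slopes:
  assumes "strictly_concave_on S f" "u \<in> S" "v \<in> S" "0 < a" "0 < b" "a < v - u" "b < v - u"
  shows "(f v - f (v - b)) / b < (f (u + a) - f u) / a"
proof -
  define L where "L = v - u"
  have L: "0 < L" "a < L" "b < L" using assms unfolding L_def by auto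
  have conc: "f ((1 - t) * u + t * v) > (1 - t) * f u + t * f v" if "0 < t" "t < 1" for t
    using assms(1-3) L(1) that unfolding strictly_concave_on_def L_def by auto
  have v: "v = u + L" unfolding L_def by simp
  have "(1 - a / L) * u + a / L * v = u + a"
    unfolding v using L(1) by (simp add: field_simps)
  then have "f (u + a) > (1 - a / L) * f u + a / L * f v"
    using conc[of "a / L"] assms(4) L by simp
  then have "f (u + a) - f u > a * ((f v - f u) / L)"
    by (simp add: algebra_simps diff_divide_distrib)
  then have 1: "(f v - f u) / L < (f (u + a) - f u) / a"
    using assms(4) by (simp add: pos_less_divide_eq mult.commute)
  have "(1 - (1 - b / L)) * u + (1 - b / L) * v = v - b"
    unfolding v using L(1) by (simp add: field_simps)
  then have "f (v - b) > (1 - (1 - b / L)) * f u + (1 - b / L) * f v"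
    using conc[of "1 - b / L"] assms(5) L by simp
  then have "f v - f (v - b) < b * ((f v - f u) / L)"
    by (simp add: algebra_simps diff_divide_distrib)
  then have 2: "(f v - f (v - b)) / b < (f v - f u) / L"
    using assms(5) by (simp add: pos_divide_less_eq mult.commute)
  from 1 2 show ?thesis by linarith
qed

text \<open>\<open>tight\<close> is complementary slackness for the bounds \<open>0 \<le> y i j\<close>.\<close>

locale balanced_flow =
  fixes I :: "'i set" and J :: "'j set" and C :: "'j \<Rightarrow> real" and R :: "'i \<Rightarrow> 'j set"
    and n :: "'i \<Rightarrow> nat" and x :: "'i \<Rightarrow> real" and y :: "'i \<Rightarrow> 'j \<Rightarrow> real"
  assumes network: "network I J C R"
    and nonneg: "i \<in> I \<Longrightarrow> j \<in> R i \<Longrightarrow> 0 \<le> y i j"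
    and rate: "i \<in> I \<Longrightarrow> (\<Sum>j\<in>R i. y i j) = x i"
    and load_le: "j \<in> J \<Longrightarrow> (\<Sum>i | i \<in> I \<and> j \<in> R i. real (n i) * y i j) \<le> C j"
    and saturated: "i \<in> I \<Longrightarrow> 0 < n i \<Longrightarrow> j \<in> R i \<Longrightarrow>
      (\<Sum>i | i \<in> I \<and> j \<in> R i. real (n i) * y i j) = C j"
    and tight: "i \<in> I \<Longrightarrow> 0 < n i \<Longrightarrow> j \<in> R i \<Longrightarrow> 0 < y i j \<Longrightarrow>
      k \<in> I \<Longrightarrow> 0 < n k \<Longrightarrow> j \<in> R k \<Longrightarrow> x i \<le> x k"

text \<open>Rates change at the single resource \<open>j\<close> only, so every other load stays as
  it is. As \<open>d\<close> vanishes for users without access to \<open>j\<close>, the load of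
  \<open>j\<close> changes by the sum over all of \<open>I\<close>. Both exchanges below are
  instances: one user takes up slack, or two users trade at constant load.\<close>

lemma feasible_perturb:
  assumes "network I J C R" "j \<in> J"
    and nonneg: "\<forall>i\<in>I. \<forall>j\<in>R i. 0 \<le> y i j"
    and rate: "\<forall>i\<in>I. (\<Sum>j\<in>R i. y i j) = x i"
    and load: "\<forall>j\<in>J. (\<Sum>i | i \<in> I \<and> j \<in> R i. real (n i) * y i j) \<le> C j"
    and supp: "\<forall>i\<in>I. j \<in> R i \<longrightarrow> 0 \<le> y i j + d i" "\<forall>i\<in>I. j \<notin> R i \<longrightarrow> d i = 0"
    and slack: "(\<Sum>i | i \<in> I \<and> j \<in> R i. real (n i) * y i j) + (\<Sum>i\<in>I. real (n i) * d i) \<le> C j"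
  shows "feasible I J C R n (\<lambda>i. x i + d i)"
proof -
  define y' where "y' = (\<lambda>i l. y i l + (if l = j then d i else 0))"
  have fin: "finite I" "finite J" "\<forall>i\<in>I. R i \<subseteq> J"
    using assms(1) unfolding network_def by auto
  have "(\<Sum>i | i \<in> I \<and> l \<in> R i. real (n i) * y' i l) \<le> C l" if "l \<in> J" for l
  proof (cases "l = j")
    case True
    have "(\<Sum>i\<in>I. real (n i) * d i) = (\<Sum>i | i \<in> I \<and> j \<in> R i. real (n i) * d i)"
      using fin supp(2) by (intro sum.mono_neutral_right) auto
    then show ?thesis using slack True
      unfolding y'_def by (simp add: algebra_simps sum.distrib)
  next
    case False
    then show ?thesis using load that unfolding y'_def by simp
  qed
  moreover have "(\<Sum>l\<in>R i. y' i l) = x i + d i" if "i \<in> I" for i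
  proof -
    have "finite (R i)" using fin that finite_subset by blast
    then show ?thesis using rate supp(2) that unfolding y'_def
      by (auto simp: sum.distrib)
  qed
  moreover have "0 \<le> y' i l" if "i \<in> I" "l \<in> R i" for i l
    using nonneg supp(1) that unfolding y'_def by auto
  ultimately show ?thesis unfolding feasible_def by (intro exI[of _ y']) simp
qed

text \<open>Any decomposition \<open>y\<close> witnessing the feasibility of \<open>x\<close> will
  do: if saturation or tightness failed, a perturbation at one resource would raise the total
  utility.\<close>

lemma optimal_allocation_balanced_flow:
  fixes n :: "'i \<Rightarrow> nat" and x :: "'i \<Rightarrow> real"
  assumes net: "network I J C R" and util: "utility_on D U"
    and opt: "optimal_allocation I J C R D U n x"
  obtains y where "balanced_flow I J C R n x y"
proof -
  from opt obtain y where
    y: "\<forall>j\<in>J. (\<Sum>i | i \<in> I \<and> j \<in> R i. real (n i) * y i j) \<le> C j"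
      "\<forall>i\<in>I. (\<Sum>j\<in>R i. y i j) = x i" "\<forall>i\<in>I. \<forall>j\<in>R i. 0 \<le> y i j"
    unfolding optimal_allocation_def feasible_def by blast
  have fin: "finite I" and RJ: "\<forall>i\<in>I. R i \<subseteq> J"
    using net unfolding network_def by auto
  have xD: "x i \<in> D" if "i \<in> I" "0 < n i" for i
    using opt that unfolding optimal_allocation_def finite_utility_def by auto
  \<comment> \<open>Upward closure keeps perturbed allocations among those of finite utility, the
    only competitors of \<open>x\<close>.\<close>
  have up: "b \<in> D" if "a \<in> D" "a \<le> b" for a b
    using util that unfolding utility_on_def by auto
  have mono: "U a < U b" if "a \<in> D" "a < b" for a b
    using util that up[of a b] unfolding utility_on_def strict_mono_on_def by auto
  have best: "(\<Sum>i\<in>I. real (n i) * (U (x i + d i) - U (x i))) \<le> 0"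
    if "feasible I J C R n (\<lambda>i. x i + d i)" "\<forall>i\<in>I. 0 < n i \<longrightarrow> x i + d i \<in> D" for d
    using opt that unfolding optimal_allocation_def finite_utility_def
    by (simp add: right_diff_distrib sum_subtractf)
  have "(\<Sum>i | i \<in> I \<and> j \<in> R i. real (n i) * y i j) = C j"
    if i: "i \<in> I" "0 < n i" "j \<in> R i" for i j
  proof (rule ccontr)
    assume *: "\<not> ?thesis"
    have jJ: "j \<in> J" using i RJ by auto
    define e where "e = (C j - (\<Sum>i | i \<in> I \<and> j \<in> R i. real (n i) * y i j)) / real (n i)"
    have "(\<Sum>i | i \<in> I \<and> j \<in> R i. real (n i) * y i j) < C j"
      using * y(1) jJ by (meson order_le_imp_less_or_eq)
    then have e: "0 < e" using i unfolding e_def by simp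
    define d where "d = (\<lambda>k. if k = i then e else 0)"
    have "(\<Sum>k\<in>I. real (n k) * d k) = real (n i) * e"
      using fin i unfolding d_def by (simp add: if_distrib cong: if_cong)
    also have "\<dots> = C j - (\<Sum>i | i \<in> I \<and> j \<in> R i. real (n i) * y i j)"
      using i unfolding e_def by simp
    finally have "feasible I J C R n (\<lambda>k. x k + d k)"
      using y e i by (intro feasible_perturb[OF net jJ y(3,2,1)]) (auto simp: d_def)
    moreover have "\<forall>k\<in>I. 0 < n k \<longrightarrow> x k + d k \<in> D"
      using xD up[OF xD[OF i(1,2)], of "x i + e"] e by (simp add: d_def)
    ultimately have "(\<Sum>k\<in>I. real (n k) * (U (x k + d k) - U (x k))) \<le> 0" by (rule best)
    moreover have "(\<Sum>k\<in>I. real (n k) * (U (x k + d k) - U (x k)))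
        = (\<Sum>k\<in>I. if k = i then real (n i) * (U (x i + e) - U (x i)) else 0)"
      unfolding d_def by (intro sum.cong) auto
    ultimately have "real (n i) * (U (x i + e) - U (x i)) \<le> 0" using fin i by simp
    moreover have "U (x i) < U (x i + e)" using mono xD i e by simp
    ultimately show False using i by (simp add: mult_le_0_iff)
  qed
  moreover have "x i \<le> x k"
    if i: "i \<in> I" "0 < n i" "j \<in> R i" "0 < y i j" and k: "k \<in> I" "0 < n k" "j \<in> R k" for i j k
  proof (rule ccontr)
    assume "\<not> ?thesis"
    then have less: "x k < x i" by simp
    then have neq: "i \<noteq> k" by auto
    have jJ: "j \<in> J" using i RJ by auto
    \<comment> \<open>The capacity moved from \<open>i\<close> to \<open>k\<close>; each flow of
      \<open>k\<close> gains \<open>a\<close> and each flow of \<open>i\<close> loses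
      \<open>b\<close>. Since \<open>n i\<close> and \<open>n k\<close> are at least 1,
      \<open>a\<close> and \<open>b\<close> are at most \<open>e\<close>: the bound
      \<open>y i j\<close> keeps \<open>y\<close> nonnegative, and half the gap keeps
      \<open>a\<close> and \<open>b\<close> below \<open>x i - x k\<close>.\<close>
    define e where "e = min (y i j) ((x i - x k) / 2)"
    define a where "a = e / real (n k)"
    define b where "b = e / real (n i)"
    have e: "0 < e" "e \<le> y i j" "e < x i - x k" using i less unfolding e_def min_def by auto
    have "a \<le> e" "b \<le> e"
      using e i k unfolding a_def b_def by (auto simp: divide_le_eq)
    moreover have "0 < a" "0 < b" using e i k unfolding a_def b_def by auto
    ultimately have ab: "0 < a" "0 < b" "a < x i - x k" "b < x i - x k" "b \<le> y i j"
      using e by auto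
    \<comment> \<open>This turns each weighted utility change into \<open>e\<close> times a
      difference quotient, ready for the comparison of slopes.\<close>
    have nab: "real (n k) = e / a" "real (n i) = e / b"
      using e i k unfolding a_def b_def by auto
    define d where "d = (\<lambda>l. if l = k then a else if l = i then - b else 0)"
    have two: "(\<Sum>l\<in>I. g l) = g k + g i" if "\<forall>l\<in>I. l \<noteq> k \<and> l \<noteq> i \<longrightarrow> g l = 0" for g :: "'i \<Rightarrow> real"
    proof -
      have "(\<Sum>l\<in>I. g l) = (\<Sum>l\<in>{k, i}. g l)"
        using fin i k that by (intro sum.mono_neutral_right) auto
      then show ?thesis using neq by simp
    qed
    have "(\<Sum>l\<in>I. real (n l) * d l) = 0"
      using two[of "\<lambda>l. real (n l) * d l"] neq nab ab by (simp add: d_def)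
    then have "feasible I J C R n (\<lambda>l. x l + d l)"
      using y ab i k jJ by (intro feasible_perturb[OF net jJ y(3,2,1)]) (auto simp: d_def)
    \<comment> \<open>The lowered rate \<open>x i - b\<close> still exceeds \<open>x k\<close>,
      which lies in \<open>D\<close>.\<close>
    moreover have "\<forall>l\<in>I. 0 < n l \<longrightarrow> x l + d l \<in> D"
      using xD up[OF xD[OF k(1,2)], of "x k + a"] up[OF xD[OF k(1,2)], of "x i - b"] ab
      by (simp add: d_def)
    ultimately have "(\<Sum>l\<in>I. real (n l) * (U (x l + d l) - U (x l))) \<le> 0" by (rule best)
    then have "real (n k) * (U (x k + a) - U (x k)) + real (n i) * (U (x i - b) - U (x i)) \<le> 0"
      using two[of "\<lambda>l. real (n l) * (U (x l + d l) - U (x l))"] neq by (simp add: d_def)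
    then have "e * ((U (x k + a) - U (x k)) / a) \<le> e * ((U (x i) - U (x i - b)) / b)"
      unfolding nab by (simp add: algebra_simps diff_divide_distrib)
    moreover have "(U (x i) - U (x i - b)) / b < (U (x k + a) - U (x k)) / a"
      using util xD i k ab unfolding utility_on_def
      by (intro strictly_concave_on_slopes[of D]) auto
    ultimately show False using e(1) by (meson mult_le_cancel_left_pos not_le)
  qed
  ultimately have "balanced_flow I J C R n x y"
    using net y by unfold_locales auto
  then show thesis by (rule that)
qed

section \<open>Counting capacity in a balanced flow\<close>

context balanced_flow
begin

lemma fin: "finite I" "finite J" and R_sub: "i \<in> I \<Longrightarrow> R i \<subseteq> J"
  and R_nonempty: "i \<in> I \<Longrightarrow> R i \<noteq> {}" and C_pos: "j \<in> J \<Longrightarrow> 0 < C j"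
  using network unfolding network_def by auto

lemma fin_R: "i \<in> I \<Longrightarrow> finite (R i)"
  using R_sub fin finite_subset by blast

lemma C_sum_pos: "J' \<subseteq> J \<Longrightarrow> J' \<noteq> {} \<Longrightarrow> 0 < (\<Sum>j\<in>J'. C j)"
  using fin C_pos finite_subset by (intro sum_pos) blast+

lemma sum_load:
  assumes "J' \<subseteq> J"
  shows "(\<Sum>j\<in>J'. \<Sum>i | i \<in> I \<and> j \<in> R i. real (n i) * y i j)
    = (\<Sum>i\<in>I. real (n i) * (\<Sum>j\<in>R i \<inter> J'. y i j))"
proof -
  have fJ: "finite J'" using assms fin finite_subset by blast
  have "(\<Sum>j\<in>J'. \<Sum>i | i \<in> I \<and> j \<in> R i. real (n i) * y i j)
      = (\<Sum>i\<in>I. \<Sum>j | j \<in> J' \<and> j \<in> R i. real (n i) * y i j)"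
    using fin(1) fJ by (rule sum.swap_restrict[symmetric])
  also have "\<dots> = (\<Sum>i\<in>I. real (n i) * (\<Sum>j\<in>R i \<inter> J'. y i j))"
    by (intro sum.cong refl) (simp add: sum_distrib_left Int_def conj_commute)
  finally show ?thesis .
qed

lemma partial_rate_bounds:
  assumes "i \<in> I"
  shows "0 \<le> (\<Sum>j\<in>R i \<inter> J'. y i j)" "(\<Sum>j\<in>R i \<inter> J'. y i j) \<le> x i"
proof -
  show "0 \<le> (\<Sum>j\<in>R i \<inter> J'. y i j)" using nonneg assms by (intro sum_nonneg) auto
  have "(\<Sum>j\<in>R i \<inter> J'. y i j) \<le> (\<Sum>j\<in>R i. y i j)"
    using nonneg assms fin_R by (intro sum_mono2) auto
  then show "(\<Sum>j\<in>R i \<inter> J'. y i j) \<le> x i" using rate assms by simp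
qed

text \<open>Users within \<open>J'\<close> draw their whole rate from \<open>J'\<close>, so its
  resources carry at least \<open>m\<close> for each of their flows. The product form also covers
  sets whose users have no flows.\<close>

lemma capacity_ge_inner:
  assumes "J' \<subseteq> J" "\<And>i. i \<in> I \<Longrightarrow> 0 < n i \<Longrightarrow> m \<le> x i"
  shows "m * (\<Sum>i\<in>users_within I R J'. real (n i)) \<le> (\<Sum>j\<in>J'. C j)"
proof -
  have "m * (\<Sum>i\<in>users_within I R J'. real (n i)) \<le> (\<Sum>i\<in>users_within I R J'. real (n i) * x i)"
    unfolding sum_distrib_left users_within_def
  proof (rule sum_mono)
    fix i assume "i \<in> {i \<in> I. R i \<subseteq> J'}"
    then show "m * real (n i) \<le> real (n i) * x i"
      using assms(2)[of i] by (cases "n i = 0") (auto simp: mult.commute)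
  qed
  also have "\<dots> = (\<Sum>i\<in>users_within I R J'. real (n i) * (\<Sum>j\<in>R i \<inter> J'. y i j))"
    using rate unfolding users_within_def by (intro sum.cong) (auto simp: Int_absorb2)
  also have "\<dots> \<le> (\<Sum>i\<in>I. real (n i) * (\<Sum>j\<in>R i \<inter> J'. y i j))"
    using fin partial_rate_bounds(1) unfolding users_within_def by (intro sum_mono2) auto
  also have "\<dots> \<le> (\<Sum>j\<in>J'. C j)"
    using load_le assms(1) unfolding sum_load[OF assms(1), symmetric] by (intro sum_mono) auto
  finally show ?thesis .
qed

text \<open>Each resource of \<open>J'\<close> is open to a user with flows and hence saturated, so
  the capacity of \<open>J'\<close> is fully shared among users meeting \<open>J'\<close>, at most
  \<open>M\<close> per flow.\<close>

lemma capacity_le_outer: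
  assumes "J' \<subseteq> J" "\<And>j. j \<in> J' \<Longrightarrow> \<exists>i\<in>I. j \<in> R i \<and> 0 < n i"
    and M: "\<And>i. i \<in> I \<Longrightarrow> 0 < n i \<Longrightarrow> x i \<le> M"
  shows "(\<Sum>j\<in>J'. C j) \<le> M * (\<Sum>i | i \<in> I \<and> R i \<inter> J' \<noteq> {}. real (n i))"
proof -
  have "(\<Sum>j\<in>J'. C j) = (\<Sum>j\<in>J'. \<Sum>i | i \<in> I \<and> j \<in> R i. real (n i) * y i j)"
    using saturated assms(2) by (intro sum.cong) (auto dest!: assms(2))
  also have "\<dots> = (\<Sum>i\<in>I. real (n i) * (\<Sum>j\<in>R i \<inter> J'. y i j))"
    by (rule sum_load[OF assms(1)])
  also have "\<dots> = (\<Sum>i | i \<in> I \<and> R i \<inter> J' \<noteq> {}. real (n i) * (\<Sum>j\<in>R i \<inter> J'. y i j))"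
    using fin by (intro sum.mono_neutral_right) auto
  also have "\<dots> \<le> (\<Sum>i | i \<in> I \<and> R i \<inter> J' \<noteq> {}. M * real (n i))"
  proof (rule sum_mono)
    fix i assume "i \<in> {i \<in> I. R i \<inter> J' \<noteq> {}}"
    then show "real (n i) * (\<Sum>j\<in>R i \<inter> J'. y i j) \<le> M * real (n i)"
      using M[of i] partial_rate_bounds(2)[of i J']
      by (cases "n i = 0") (auto simp: mult.commute)
  qed
  finally show ?thesis by (simp add: sum_distrib_left)
qed

section \<open>Sets of resources attaining the bounds\<close>

lemma inner_attained:
  assumes "i0 \<in> I" "0 < n i0" "x i0 = m" "\<And>i. i \<in> I \<Longrightarrow> 0 < n i \<Longrightarrow> m \<le> x i"
  obtains J' where "J' \<subseteq> J" "J' \<noteq> {}"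
    "(\<Sum>j\<in>J'. C j) \<le> m * (\<Sum>i\<in>users_within I R J'. real (n i))"
proof -
  define T where "T = {i \<in> I. 0 < n i \<and> x i = m}"
  define J' where "J' = (\<Union>i\<in>T. R i)"
  have J': "J' \<subseteq> J" using R_sub unfolding J'_def T_def by auto
  have "J' \<noteq> {}" using R_nonempty[of i0] assms unfolding J'_def T_def by auto
  \<comment> \<open>If a user with flows outside \<open>T\<close> drew on a resource of
    \<open>J'\<close>, \<open>tight\<close> would bound its rate by that of a user in
    \<open>T\<close>, forcing it into \<open>T\<close>. So the whole capacity of \<open>J'\<close>
    serves \<open>T\<close>.\<close>
  have idle: "real (n i) * (\<Sum>j\<in>R i \<inter> J'. y i j) = 0" if "i \<in> I - T" for i
  proof (cases "n i = 0")
    case False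
    have "y i j = 0" if j: "j \<in> R i \<inter> J'" for j
    proof (rule ccontr)
      assume "y i j \<noteq> 0"
      then have "0 < y i j" using nonneg[of i j] j \<open>i \<in> I - T\<close> by auto
      moreover obtain k where "k \<in> T" "j \<in> R k" using j unfolding J'_def by auto
      ultimately have "x i \<le> m" using tight[of i j k] False j \<open>i \<in> I - T\<close> unfolding T_def by auto
      then show False using assms(4)[of i] False \<open>i \<in> I - T\<close> unfolding T_def by auto
    qed
    then show ?thesis by simp
  qed simp
  \<comment> \<open>For the empty set the two bounds on partial rates give nonnegativity of the rate
    itself. It is needed to enlarge the sum over \<open>T\<close> to all users within
    \<open>J'\<close>.\<close>
  have m0: "0 \<le> m" using partial_rate_bounds[of i0 "{}"] assms by simp
  have "(\<Sum>j\<in>J'. C j) = (\<Sum>j\<in>J'. \<Sum>i | i \<in> I \<and> j \<in> R i. real (n i) * y i j)"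
    using saturated unfolding J'_def T_def by (intro sum.cong) auto
  also have "\<dots> = (\<Sum>i\<in>I. real (n i) * (\<Sum>j\<in>R i \<inter> J'. y i j))"
    by (rule sum_load[OF J'])
  also have "\<dots> = (\<Sum>i\<in>T. real (n i) * (\<Sum>j\<in>R i \<inter> J'. y i j))"
    using fin idle by (intro sum.mono_neutral_right) (auto simp: T_def)
  also have "\<dots> \<le> (\<Sum>i\<in>T. m * real (n i))"
    using partial_rate_bounds(2)[of _ J'] by (intro sum_mono) (auto simp: T_def mult.commute)
  also have "\<dots> \<le> (\<Sum>i\<in>users_within I R J'. m * real (n i))"
    using fin m0 by (intro sum_mono2) (auto simp: T_def J'_def users_within_def)
  finally show thesis using that J' \<open>J' \<noteq> {}\<close> by (simp add: sum_distrib_left)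
qed

text \<open>Here \<open>J'\<close> consists of the resources actually serving users of rate
  \<open>M\<close>, not of all accessible ones. These users get everything from \<open>J'\<close>,
  and by \<open>tight\<close> no other user with flows has access to it.\<close>

lemma outer_attained:
  assumes "i0 \<in> I" "0 < n i0" "x i0 = M" "0 < M" "\<And>i. i \<in> I \<Longrightarrow> 0 < n i \<Longrightarrow> x i \<le> M"
  obtains J' where "J' \<subseteq> J" "J' \<noteq> {}"
    "M * (\<Sum>i | i \<in> I \<and> R i \<inter> J' \<noteq> {}. real (n i)) \<le> (\<Sum>j\<in>J'. C j)"
proof -
  define T where "T = {i \<in> I. 0 < n i \<and> x i = M}"
  define J' where "J' = (\<Union>i\<in>T. {j \<in> R i. 0 < y i j})"
  have J': "J' \<subseteq> J" using R_sub unfolding J'_def T_def by auto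
  have full: "(\<Sum>j\<in>R i \<inter> J'. y i j) = M" if "i \<in> T" for i
  proof -
    have "y i j = 0" if "j \<in> R i - J'" for j
      using that \<open>i \<in> T\<close> nonneg[of i j] unfolding J'_def T_def by force
    then have "(\<Sum>j\<in>R i \<inter> J'. y i j) = (\<Sum>j\<in>R i. y i j)"
      using fin_R \<open>i \<in> T\<close> by (intro sum.mono_neutral_left) (auto simp: T_def)
    then show ?thesis using rate \<open>i \<in> T\<close> by (auto simp: T_def)
  qed
  \<comment> \<open>Positivity of \<open>M\<close> enters: a user of rate zero could have an empty
    support.\<close>
  have "J' \<noteq> {}" using full[of i0] assms by (auto simp: T_def)
  have top: "i \<in> T" if i: "i \<in> I" "0 < n i" "R i \<inter> J' \<noteq> {}" for i
  proof -
    obtain j k where "j \<in> R i" "k \<in> T" "j \<in> R k" "0 < y k j"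
      using i unfolding J'_def by auto
    then have "M \<le> x i" using tight[of k j i] i unfolding T_def by auto
    then show ?thesis using assms(5)[of i] i unfolding T_def by auto
  qed
  have "M * (\<Sum>i | i \<in> I \<and> R i \<inter> J' \<noteq> {}. real (n i))
      = (\<Sum>i | i \<in> I \<and> 0 < n i \<and> R i \<inter> J' \<noteq> {}. real (n i) * M)"
    unfolding sum_distrib_left using fin
    by (intro sum.mono_neutral_cong_right) (auto simp: mult.commute)
  also have "\<dots> \<le> (\<Sum>i\<in>T. real (n i) * M)"
    using fin top assms by (intro sum_mono2) (auto simp: T_def)
  also have "\<dots> = (\<Sum>i\<in>T. real (n i) * (\<Sum>j\<in>R i \<inter> J'. y i j))"
    using full by simp
  also have "\<dots> \<le> (\<Sum>i\<in>I. real (n i) * (\<Sum>j\<in>R i \<inter> J'. y i j))"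
    using fin partial_rate_bounds(1) by (intro sum_mono2) (auto simp: T_def)
  also have "\<dots> \<le> (\<Sum>j\<in>J'. C j)"
    using load_le J' unfolding sum_load[OF J', symmetric] by (intro sum_mono) auto
  finally show thesis using that J' \<open>J' \<noteq> {}\<close> by blast
qed

section \<open>Reduction to connected sets\<close>

text \<open>A witness of least cardinality is strongly connected: were it split, both parts would
  violate the inequality strictly, and adding the violations would contradict it for the whole,
  because the users within \<open>J'\<close> are distributed over the two parts.\<close>

lemma inner_attained_connected:
  assumes "J0 \<subseteq> J" "J0 \<noteq> {}"
    "(\<Sum>j\<in>J0. C j) \<le> m * (\<Sum>i\<in>users_within I R J0. real (n i))" "0 \<le> m"
  obtains J' where "J' \<in> strongly_connected_subsets I J R"
    "(\<Sum>j\<in>J'. C j) \<le> m * (\<Sum>i\<in>users_within I R J'. real (n i))"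
proof -
  define N where "N = (\<lambda>J'. \<Sum>i\<in>users_within I R J'. real (n i))"
  define P where "P = (\<lambda>J'. J' \<subseteq> J \<and> J' \<noteq> {} \<and> (\<Sum>j\<in>J'. C j) \<le> m * N J')"
  have "P J0" using assms unfolding P_def N_def by auto
  then obtain J' where P: "P J'" and least: "\<And>K. P K \<Longrightarrow> card J' \<le> card K"
    by (metis exists_least_iff[of "\<lambda>c. \<exists>K. P K \<and> card K = c"] not_le)
  have finJ': "finite J'" using P fin finite_subset unfolding P_def by blast
  have "connected_pair R (users_within I R J') J'"
    unfolding connected_pair_def
  proof (rule notI, elim exE conjE)
    fix J1 J2 I1 I2
    assume J12: "J1 \<noteq> {}" "J2 \<noteq> {}" "J1 \<union> J2 = J'" "J1 \<inter> J2 = {}"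
      and I12: "I1 \<union> I2 = users_within I R J'" "I1 \<inter> I2 = {}"
        "\<forall>i\<in>I1. R i \<inter> J2 = {}" "\<forall>i\<in>I2. R i \<inter> J1 = {}"
    have fin12: "finite J1" "finite J2" using finJ' J12 by auto
    have "card J1 < card J'" "card J2 < card J'"
      using J12 finJ' by (auto intro!: psubset_card_mono)
    then have "\<not> P J1" "\<not> P J2" using least leD by blast+
    then have "m * N J1 + m * N J2 < (\<Sum>j\<in>J1. C j) + (\<Sum>j\<in>J2. C j)"
      using P J12 unfolding P_def by auto
    also have "\<dots> = (\<Sum>j\<in>J'. C j)"
      using fin12 J12 by (metis sum.union_disjoint)
    also have "\<dots> \<le> m * N J'" using P unfolding P_def by auto
    also have "\<dots> \<le> m * (N J1 + N J2)"
    proof (rule mult_left_mono[OF _ assms(4)])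
      have fw: "finite (users_within I R K)" for K using fin unfolding users_within_def by auto
      then have fI: "finite I1" "finite I2" using I12(1) by (metis finite_Un)+
      have "N J' = (\<Sum>i\<in>I1. real (n i)) + (\<Sum>i\<in>I2. real (n i))"
        unfolding N_def using I12(1,2) fI by (metis sum.union_disjoint)
      also have "\<dots> \<le> N J1 + N J2"
      proof -
        \<comment> \<open>A user within \<open>J'\<close> that misses \<open>J2\<close> is within
          \<open>J1\<close>, and symmetrically.\<close>
        have "I1 \<subseteq> users_within I R J1" "I2 \<subseteq> users_within I R J2"
          using I12 J12 unfolding users_within_def by blast+
        then show ?thesis unfolding N_def using fw by (intro add_mono sum_mono2) auto
      qed
      finally show "N J' \<le> N J1 + N J2" .
    qed
    finally show False by (simp add: distrib_left)
  qed
  then show thesis using that P unfolding P_def N_def strongly_connected_subsets_def by blast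
qed

text \<open>The same minimality argument with reversed inequalities; now the flow counts of the two
  parts add up exactly.\<close>

lemma outer_attained_connected:
  assumes "J0 \<subseteq> J" "J0 \<noteq> {}"
    "M * (\<Sum>i | i \<in> I \<and> R i \<inter> J0 \<noteq> {}. real (n i)) \<le> (\<Sum>j\<in>J0. C j)" "0 \<le> M"
  obtains J' where "J' \<in> connected_subsets I J R"
    "M * (\<Sum>i | i \<in> I \<and> R i \<inter> J' \<noteq> {}. real (n i)) \<le> (\<Sum>j\<in>J'. C j)"
proof -
  define N where "N = (\<lambda>J'. \<Sum>i | i \<in> I \<and> R i \<inter> J' \<noteq> {}. real (n i))"
  define P where "P = (\<lambda>J'. J' \<subseteq> J \<and> J' \<noteq> {} \<and> M * N J' \<le> (\<Sum>j\<in>J'. C j))"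
  have "P J0" using assms unfolding P_def N_def by auto
  then obtain J' where P: "P J'" and least: "\<And>K. P K \<Longrightarrow> card J' \<le> card K"
    by (metis exists_least_iff[of "\<lambda>c. \<exists>K. P K \<and> card K = c"] not_le)
  have finJ': "finite J'" using P fin finite_subset unfolding P_def by blast
  have "connected_pair R I J'"
    unfolding connected_pair_def
  proof (rule notI, elim exE conjE)
    fix J1 J2 I1 I2
    assume J12: "J1 \<noteq> {}" "J2 \<noteq> {}" "J1 \<union> J2 = J'" "J1 \<inter> J2 = {}"
      and I12: "I1 \<union> I2 = I" "I1 \<inter> I2 = {}"
        "\<forall>i\<in>I1. R i \<inter> J2 = {}" "\<forall>i\<in>I2. R i \<inter> J1 = {}"
    have fin12: "finite J1" "finite J2" using finJ' J12 by auto
    have "card J1 < card J'" "card J2 < card J'"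
      using J12 finJ' by (auto intro!: psubset_card_mono)
    then have "\<not> P J1" "\<not> P J2" using least leD by blast+
    then have less: "(\<Sum>j\<in>J1. C j) + (\<Sum>j\<in>J2. C j) < M * N J1 + M * N J2"
      using P J12 unfolding P_def by auto
    \<comment> \<open>A user meeting both parts could belong to neither \<open>I1\<close> nor
      \<open>I2\<close>.\<close>
    have "{i \<in> I. R i \<inter> J1 \<noteq> {}} \<inter> {i \<in> I. R i \<inter> J2 \<noteq> {}} = {}"
      using I12 by blast
    moreover have "{i \<in> I. R i \<inter> J1 \<noteq> {}} \<union> {i \<in> I. R i \<inter> J2 \<noteq> {}} = {i \<in> I. R i \<inter> J' \<noteq> {}}"
      using J12 by blast
    ultimately have "N J1 + N J2 = N J'"
      unfolding N_def using fin by (subst sum.union_disjoint[symmetric]) auto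
    then have "M * N J1 + M * N J2 = M * N J'" by (metis distrib_left)
    also have "\<dots> \<le> (\<Sum>j\<in>J'. C j)" using P unfolding P_def by auto
    also have "\<dots> = (\<Sum>j\<in>J1. C j) + (\<Sum>j\<in>J2. C j)"
      using fin12 J12 by (metis sum.union_disjoint)
    finally show False using less by simp
  qed
  then show thesis using that P unfolding P_def N_def connected_subsets_def by blast
qed

section \<open>The extremal rates\<close>

lemma min_rate:
  assumes "\<exists>i\<in>I. 0 < n i"
  shows "ereal (MIN i\<in>{i\<in>I. n i > 0}. x i) =
    (MIN J'\<in>strongly_connected_subsets I J R. inner_ratio I C R n J')"
proof -
  define m where "m = (MIN i\<in>{i\<in>I. n i > 0}. x i)"
  have "m \<in> x ` {i\<in>I. n i > 0}" using fin assms unfolding m_def by (intro Min_in) auto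
  then obtain i0 where i0: "i0 \<in> I" "0 < n i0" "x i0 = m" by auto
  have m: "m \<le> x i" if "i \<in> I" "0 < n i" for i
    using fin that unfolding m_def by (intro Min_le) auto
  have m0: "0 \<le> m" using partial_rate_bounds[of i0 "{}"] i0 by simp
  obtain J0 where "J0 \<subseteq> J" "J0 \<noteq> {}"
    "(\<Sum>j\<in>J0. C j) \<le> m * (\<Sum>i\<in>users_within I R J0. real (n i))"
    using inner_attained[OF i0 m] by blast
  then obtain J' where J': "J' \<in> strongly_connected_subsets I J R"
    "(\<Sum>j\<in>J'. C j) \<le> m * (\<Sum>i\<in>users_within I R J'. real (n i))"
    using inner_attained_connected m0 by blast
  have lower: "ereal m \<le> inner_ratio I C R n K" if "K \<in> strongly_connected_subsets I J R" for K
  proof -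
    have K: "K \<subseteq> J" "K \<noteq> {}" using that unfolding strongly_connected_subsets_def by auto
    show ?thesis
    proof (cases "(\<Sum>i\<in>users_within I R K. real (n i)) = 0")
      \<comment> \<open>Without flows the denominator is zero and the positive capacity makes the
        ratio \<infinity>.\<close>
      case True
      then show ?thesis using C_sum_pos[OF K] unfolding inner_ratio_def ereal_divide by simp
    next
      case False
      then have "0 < (\<Sum>i\<in>users_within I R K. real (n i))"
        by (simp add: order.strict_iff_order sum_nonneg)
      then show ?thesis using capacity_ge_inner[OF K(1) m] False unfolding inner_ratio_def
        by (simp add: pos_le_divide_eq)
    qed
  qed
  have J'_sub: "J' \<subseteq> J" "J' \<noteq> {}" using J' unfolding strongly_connected_subsets_def by auto
  \<comment> \<open>The witness must contain flows, as otherwise its positive capacity would be at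
    most zero; its ratio is therefore finite.\<close>
  have "(\<Sum>i\<in>users_within I R J'. real (n i)) \<noteq> 0" using J'(2) C_sum_pos[OF J'_sub] by auto
  then have "0 < (\<Sum>i\<in>users_within I R J'. real (n i))"
    by (simp add: order.strict_iff_order sum_nonneg)
  then have "inner_ratio I C R n J' \<le> ereal m"
    using J'(2) unfolding inner_ratio_def by (simp add: pos_divide_le_eq)
  then have eq: "inner_ratio I C R n J' = ereal m" using lower[OF J'(1)] by simp
  have "strongly_connected_subsets I J R \<subseteq> Pow J" unfolding strongly_connected_subsets_def by blast
  then have "finite (inner_ratio I C R n ` strongly_connected_subsets I J R)"
    by (rule finite_imageI[OF finite_subset]) (simp add: fin(2))
  moreover have "ereal m \<in> inner_ratio I C R n ` strongly_connected_subsets I J R"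
    using imageI[OF J'(1), of "inner_ratio I C R n"] unfolding eq .
  ultimately have "(MIN J'\<in>strongly_connected_subsets I J R. inner_ratio I C R n J') = ereal m"
    using lower by (intro Min_eqI) auto
  then show ?thesis unfolding m_def ..
qed

text \<open>The hypothesis \<open>used\<close> makes every resource saturated and every denominator
  positive. Users of rate zero by convention may stay in the maximum because \<open>M\<close> turns
  out to be positive.\<close>

lemma max_rate:
  assumes used: "\<forall>j\<in>J. \<exists>i\<in>I. j \<in> R i \<and> 0 < n i" and zero: "\<forall>i\<in>I. n i = 0 \<longrightarrow> x i = 0"
  shows "ereal (MAX i\<in>I. x i) =
    (MAX J'\<in>connected_subsets I J R. outer_ratio I C R n J')"
proof -
  define M where "M = (MAX i\<in>I. x i)"
  have I: "I \<noteq> {}" using network unfolding network_def by auto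
  then have "M \<in> x ` I" using fin unfolding M_def by (intro Max_in) auto
  then obtain i0 where i0: "i0 \<in> I" "x i0 = M" by auto
  have M: "x i \<le> M" if "i \<in> I" for i
    using fin that unfolding M_def by (intro Max_ge) auto
  have M_nonneg: "0 \<le> M" using partial_rate_bounds[of i0 "{}"] i0 by simp
  have upper: "(\<Sum>j\<in>K. C j) \<le> M * (\<Sum>i | i \<in> I \<and> R i \<inter> K \<noteq> {}. real (n i))" if "K \<subseteq> J" for K
    using that used M by (intro capacity_le_outer) auto
  have flows: "0 < (\<Sum>i | i \<in> I \<and> R i \<inter> K \<noteq> {}. real (n i))" if "K \<subseteq> J" "K \<noteq> {}" for K
  proof -
    have "(\<Sum>i | i \<in> I \<and> R i \<inter> K \<noteq> {}. real (n i)) \<noteq> 0"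
      using upper[OF that(1)] C_sum_pos[OF that] by auto
    then show ?thesis by (simp add: order.strict_iff_order sum_nonneg)
  qed
  have "J \<noteq> {}" using I R_nonempty R_sub by blast
  \<comment> \<open>The positive total capacity is at most \<open>M\<close> times a number of
    flows.\<close>
  then have "M \<noteq> 0" using upper[of J] C_sum_pos[of J] by auto
  then have M_pos: "0 < M" using M_nonneg by simp
  \<comment> \<open>A maximizer without flows would have rate zero by \<open>zero\<close>.\<close>
  then have "0 < n i0" using zero i0 by (cases "n i0 = 0") auto
  then obtain J0 where "J0 \<subseteq> J" "J0 \<noteq> {}"
    "M * (\<Sum>i | i \<in> I \<and> R i \<inter> J0 \<noteq> {}. real (n i)) \<le> (\<Sum>j\<in>J0. C j)"
    using outer_attained[OF i0(1) _ i0(2) M_pos M] by blast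
  then obtain J' where J': "J' \<in> connected_subsets I J R"
    "M * (\<Sum>i | i \<in> I \<and> R i \<inter> J' \<noteq> {}. real (n i)) \<le> (\<Sum>j\<in>J'. C j)"
    using outer_attained_connected M_nonneg by blast
  have sub: "K \<subseteq> J" "K \<noteq> {}" if "K \<in> connected_subsets I J R" for K
    using that unfolding connected_subsets_def by auto
  have le: "outer_ratio I C R n K \<le> ereal M" if "K \<in> connected_subsets I J R" for K
    using upper flows sub[OF that] unfolding outer_ratio_def
    by (simp add: pos_divide_le_eq less_imp_neq[symmetric])
  have "ereal M \<le> outer_ratio I C R n J'"
    using J'(2) flows sub[OF J'(1)] unfolding outer_ratio_def
    by (simp add: pos_le_divide_eq less_imp_neq[symmetric])
  then have eq: "outer_ratio I C R n J' = ereal M" using le[OF J'(1)] by simp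
  have "connected_subsets I J R \<subseteq> Pow J" unfolding connected_subsets_def by blast
  then have "finite (outer_ratio I C R n ` connected_subsets I J R)"
    by (rule finite_imageI[OF finite_subset]) (simp add: fin(2))
  moreover have "ereal M \<in> outer_ratio I C R n ` connected_subsets I J R"
    using imageI[OF J'(1), of "outer_ratio I C R n"] unfolding eq .
  ultimately have "(MAX J'\<in>connected_subsets I J R. outer_ratio I C R n J') = ereal M"
    using le by (intro Max_eqI) auto
  then show ?thesis unfolding M_def ..
qed

end

theorem theorem3p3:
  fixes I :: "'i set" and J :: "'j set"
    and C :: "'j \<Rightarrow> real" and R :: "'i \<Rightarrow> 'j set"
    and D :: "real set" and U :: "real \<Rightarrow> real"
    and n :: "'i \<Rightarrow> nat" and x :: "'i \<Rightarrow> real"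
  assumes "network I J C R"
    and "utility_on D U"
    and "optimal_allocation I J C R D U n x"
  shows "((\<forall>i\<in>I. n i > 0) \<longrightarrow>
            ereal (MIN i\<in>I. x i) =
            (MIN J'\<in>strongly_connected_subsets I J R. inner_ratio I C R n J')) \<and>
         ((\<exists>i\<in>I. n i > 0) \<longrightarrow>
            ereal (MIN i\<in>{i\<in>I. n i > 0}. x i) =
            (MIN J'\<in>strongly_connected_subsets I J R. inner_ratio I C R n J')) \<and>
         ((\<forall>j\<in>J. \<exists>i\<in>I. j \<in> R i \<and> n i > 0) \<longrightarrow>
            ereal (MAX i\<in>I. x i) =
            (MAX J'\<in>connected_subsets I J R. outer_ratio I C R n J'))"
proof -
  obtain y where "balanced_flow I J C R n x y"
    using optimal_allocation_balanced_flow[OF assms] .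
  then interpret balanced_flow I J C R n x y .
  show ?thesis
  proof (intro conjI impI)
    assume all: "\<forall>i\<in>I. n i > 0"
    have "\<exists>i\<in>I. n i > 0" using all assms(1) unfolding network_def by blast
    moreover have "{i \<in> I. n i > 0} = I" using all by blast
    ultimately show "ereal (MIN i\<in>I. x i) =
        (MIN J'\<in>strongly_connected_subsets I J R. inner_ratio I C R n J')"
      using min_rate by simp
  next
    assume "\<exists>i\<in>I. n i > 0"
    then show "ereal (MIN i\<in>{i\<in>I. n i > 0}. x i) =
        (MIN J'\<in>strongly_connected_subsets I J R. inner_ratio I C R n J')"
      by (rule min_rate)
  next
    assume "\<forall>j\<in>J. \<exists>i\<in>I. j \<in> R i \<and> n i > 0"
    moreover have "\<forall>i\<in>I. n i = 0 \<longrightarrow> x i = 0"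
      using assms(3) unfolding optimal_allocation_def by blast
    ultimately show "ereal (MAX i\<in>I. x i) =
        (MAX J'\<in>connected_subsets I J R. outer_ratio I C R n J')"
      by (rule max_rate)
  qed
qed

end
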